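(* Let $n, N \geq 1$ be integers and consider the frame potential $FP\left((u_i)_1^N\right) = \sum_{i,j=1}^N \langle u_i, u_j\rangle^2$ as a function on the set $(S^{n-1})^N$ of systems $(u_i)_1^N$ of $N$ vectors on the unit sphere $S^{n-1} \subset \mathbb{R}^n$. Then every local minimiser of $FP$ on $(S^{n-1})^N$ is also a global minimiser of $FP$ on $(S^{n-1})^N$. Furthermore, these minimising vector systems $(u_i)_1^N$ are orthonormal sets if $N \leq n$, and normalised tight frames for $\mathbb{R}^n$ if $N \geq n$.
   Context: $S^{n-1}$ is the Euclidean unit sphere of $\mathbb{R}^n$, and $(S^{n-1})^N$ carries the product topology, with respect to which local minimisers are understood. A system of vectors $u_1,\ldots,u_N$ in $\mathbb{R}^n$ is called a tight frame if there exists a constant $\lambda \in \mathbb{R}$ such that $\lambda x = \sum_{i=1}^N \langle x, u_i\rangle u_i$ for every $x \in \mathbb{R}^n$. It is a normalised (or unit-norm) tight frame if in addition all the vectors $u_i$ have norm $1$. A system $(u_i)_1^N$ is an orthonormal set if $\langle u_i, u_j\rangle = \delta_{ij}$ (Kronecker delta) for all $1 \leq i,j \leq N$. *)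

theory Defs
  imports "HOL-Analysis.Analysis"
begin

text \<open>
  A system of N vectors in n-dimensional Euclidean space is a point \<open>u\<close> of \<open>real ^ 'n ^ 'N\<close>, whose
  i-th vector is \<open>u $ i\<close>, with \<open>n = CARD('n)\<close> and \<open>N = CARD('N)\<close>. The topology of \<open>real ^ 'n ^ 'N\<close>
  is the product topology (\<open>open_vec_def\<close>), so \<open>top_of_set unit_systems\<close> is the product topology
  on the N-fold power of the unit sphere.
\<close>

definition unit_systems :: "(real ^ 'n ^ 'N) set" where
  "unit_systems = {u. \<forall>i. u $ i \<in> sphere 0 1}"

definition frame_potential :: "real ^ 'n ^ 'N \<Rightarrow> real" where
  "frame_potential u = (\<Sum>i\<in>UNIV. \<Sum>j\<in>UNIV. (u $ i \<bullet> u $ j)\<^sup>2)"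

definition global_minimiser_on :: "'a set \<Rightarrow> ('a \<Rightarrow> real) \<Rightarrow> 'a \<Rightarrow> bool" where
  "global_minimiser_on S f x \<longleftrightarrow> x \<in> S \<and> (\<forall>y\<in>S. f x \<le> f y)"

definition local_minimiser_on :: "'a::topological_space set \<Rightarrow> ('a \<Rightarrow> real) \<Rightarrow> 'a \<Rightarrow> bool" where
  "local_minimiser_on S f x \<longleftrightarrow>
     (\<exists>U. openin (top_of_set S) U \<and> x \<in> U \<and> (\<forall>y\<in>U. f x \<le> f y))"

definition orthonormal_system :: "real ^ 'n ^ 'N \<Rightarrow> bool" where
  "orthonormal_system u \<longleftrightarrow> (\<forall>i j. u $ i \<bullet> u $ j = (if i = j then 1 else 0))"

definition tight_frame :: "real ^ 'n ^ 'N \<Rightarrow> bool" where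
  "tight_frame u \<longleftrightarrow> (\<exists>c::real. \<forall>x. c *\<^sub>R x = (\<Sum>i\<in>UNIV. (x \<bullet> u $ i) *\<^sub>R (u $ i)))"

definition normalised_tight_frame :: "real ^ 'n ^ 'N \<Rightarrow> bool" where
  "normalised_tight_frame u \<longleftrightarrow> tight_frame u \<and> (\<forall>i. norm (u $ i) = 1)"

end

theory Submission imports Defs
begin

text \<open>
  With the frame operator \<open>S x = \<Sum>i. (x \<bullet> u $ i) *\<^sub>R u $ i\<close>, the potential is the squared
  Hilbert-Schmidt norm of \<open>S\<close>, and \<open>S\<close> has trace \<open>N\<close>; so it is at least \<open>N\<^sup>2 / n\<close>, with equality
  exactly for tight frames. The diagonal terms give the bound \<open>N\<close>, with equality exactly for
  orthonormal systems. Hence it suffices that a local minimiser is orthonormal or tight.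

  The first variation shows that each \<open>u $ k\<close> is an eigenvector of \<open>S\<close>. If \<open>u $ k\<close> is not
  orthogonal to all the other vectors, then the vectors in its eigenspace are linearly dependent,
  and tilting them along a dependency towards a fixed unit vector shows, through the second
  variation, that the eigenvalue of \<open>u $ k\<close> is a lower bound for \<open>S\<close>. This eigenvalue exceeds 1,
  so all \<open>u $ m\<close> have eigenvalue above 1, none is orthogonal to all the others, and by
  symmetry all eigenvalues agree. Then \<open>S \<circ> S = l *\<^sub>R S\<close> with \<open>S\<close> positive definite, so \<open>S\<close> is
  scalar.
\<close>

section \<open>The frame operator: self-adjointness and trace\<close>

definition frame_operator :: "real ^ 'n ^ 'N \<Rightarrow> real ^ 'n \<Rightarrow> real ^ 'n" where
  "frame_operator u x = (\<Sum>i\<in>UNIV. (x \<bullet> u $ i) *\<^sub>R (u $ i))"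

lemma linear_frame_operator: "linear (frame_operator u)"
  unfolding frame_operator_def
  by (rule linearI)
     (simp_all add: inner_add_left scaleR_add_left sum.distrib scaleR_sum_right)

lemma inner_frame_operator: "frame_operator u x \<bullet> y = (\<Sum>i\<in>UNIV. (x \<bullet> u $ i) * (y \<bullet> u $ i))"
  by (simp add: frame_operator_def inner_sum_left inner_commute[of y])

lemma frame_operator_selfadjoint: "frame_operator u x \<bullet> y = x \<bullet> frame_operator u y"
  by (simp add: inner_frame_operator inner_commute[of x] mult.commute)

lemma frame_operator_eigenvectors_orthogonal:
  assumes "frame_operator u x = l *\<^sub>R x" "frame_operator u y = m *\<^sub>R y" "l \<noteq> m"
  shows "x \<bullet> y = 0"
  using frame_operator_selfadjoint[of u x y] assms by simp

lemma unit_systems_inner: "u \<in> unit_systems \<Longrightarrow> u $ i \<bullet> u $ i = 1"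
  by (simp add: unit_systems_def norm_eq_1)

lemma sum_Basis_inner_mult:
  fixes x y :: "'a::euclidean_space"
  shows "(\<Sum>b\<in>Basis. (b \<bullet> x) * (b \<bullet> y)) = x \<bullet> y"
  by (simp add: euclidean_inner[of x y] inner_commute)

lemma trace_frame_operator:
  assumes "u \<in> unit_systems"
  shows "(\<Sum>b\<in>Basis. frame_operator (u :: real ^ 'n ^ 'N) b \<bullet> b) = real CARD('N)"
proof -
  have "(\<Sum>b\<in>Basis. frame_operator u b \<bullet> b) = (\<Sum>i\<in>UNIV. \<Sum>b\<in>Basis. (b \<bullet> u $ i) * (b \<bullet> u $ i))"
    unfolding inner_frame_operator by (rule sum.swap)
  also have "\<dots> = real CARD('N)"
    by (simp only: sum_Basis_inner_mult unit_systems_inner[OF assms]) simp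
  finally show ?thesis .
qed

section \<open>Lower bounds for the potential and their equality cases\<close>

lemma frame_potential_eq_sum_norm_frame_operator:
  "frame_potential u = (\<Sum>b\<in>Basis. (norm (frame_operator u b))\<^sup>2)"
proof -
  have "(norm (frame_operator u b))\<^sup>2
      = (\<Sum>i\<in>UNIV. \<Sum>j\<in>UNIV. (u $ i \<bullet> u $ j) * ((b \<bullet> u $ i) * (b \<bullet> u $ j)))" for b
    unfolding power2_norm_eq_inner inner_frame_operator
    by (simp add: frame_operator_def inner_sum_left sum_distrib_left inner_commute ac_simps)
  then have "(\<Sum>b\<in>Basis. (norm (frame_operator u b))\<^sup>2)
      = (\<Sum>b\<in>Basis. \<Sum>i\<in>UNIV. \<Sum>j\<in>UNIV. (u $ i \<bullet> u $ j) * ((b \<bullet> u $ i) * (b \<bullet> u $ j)))"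
    by simp
  also have "\<dots> = (\<Sum>i\<in>UNIV. \<Sum>b\<in>Basis. \<Sum>j\<in>UNIV. (u $ i \<bullet> u $ j) * ((b \<bullet> u $ i) * (b \<bullet> u $ j)))"
    by (rule sum.swap)
  also have "\<dots> = (\<Sum>i\<in>UNIV. \<Sum>j\<in>UNIV. \<Sum>b\<in>Basis. (u $ i \<bullet> u $ j) * ((b \<bullet> u $ i) * (b \<bullet> u $ j)))"
    by (intro sum.cong refl sum.swap)
  \<comment> \<open>Summing over \<open>b\<close> first yields a second factor
    \<open>u $ i \<bullet> u $ j\<close>, by Parseval's identity.\<close>
  also have "\<dots> = frame_potential u"
    unfolding frame_potential_def
    by (simp only: sum_distrib_left[symmetric] sum_Basis_inner_mult power2_eq_square)
  finally show ?thesis by simp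
qed

text \<open>The right-hand side is the squared Hilbert-Schmidt distance of the frame operator from
  the scalar operator of the same trace. On expanding it, the trace evaluates the cross
  term.\<close>

lemma frame_potential_tight_defect:
  fixes u :: "real ^ 'n ^ 'N"
  assumes "u \<in> unit_systems"
  defines "c \<equiv> real CARD('N) / real CARD('n)"
  shows "frame_potential u - (real CARD('N))\<^sup>2 / real CARD('n)
    = (\<Sum>b\<in>Basis. (norm (frame_operator u b - c *\<^sub>R b))\<^sup>2)"
proof -
  have "(norm (frame_operator u b - c *\<^sub>R b))\<^sup>2
      = (norm (frame_operator u b))\<^sup>2 - 2 * c * (frame_operator u b \<bullet> b) + c\<^sup>2"
    if "b \<in> Basis" for b
    using that unfolding power2_norm_eq_inner
    by (simp add: inner_diff_left inner_diff_right inner_commute power2_eq_square algebra_simps)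
  then have "(\<Sum>b\<in>Basis. (norm (frame_operator u b - c *\<^sub>R b))\<^sup>2)
      = frame_potential u - 2 * c * real CARD('N) + real CARD('n) * c\<^sup>2"
    by (simp add: sum.distrib sum_subtractf frame_potential_eq_sum_norm_frame_operator
        trace_frame_operator[OF assms(1), symmetric] sum_distrib_left)
  then show ?thesis
    by (simp add: c_def power2_eq_square field_simps)
qed

lemma frame_potential_ge_tight:
  fixes u :: "real ^ 'n ^ 'N"
  assumes "u \<in> unit_systems"
  shows "(real CARD('N))\<^sup>2 / real CARD('n) \<le> frame_potential u"
  using frame_potential_tight_defect[OF assms]
  by (smt (verit) sum_nonneg zero_le_power2)

lemma frame_potential_eq_tight_iff:
  fixes u :: "real ^ 'n ^ 'N"
  assumes "u \<in> unit_systems"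
  shows "frame_potential u = (real CARD('N))\<^sup>2 / real CARD('n) \<longleftrightarrow> tight_frame u"
proof
  define c where "c = real CARD('N) / real CARD('n)"
  assume "frame_potential u = (real CARD('N))\<^sup>2 / real CARD('n)"
  then have "(\<Sum>b\<in>Basis. (norm (frame_operator u b - c *\<^sub>R b))\<^sup>2) = 0"
    using frame_potential_tight_defect[OF assms] by (simp add: c_def)
  then have "frame_operator u b = c *\<^sub>R b" if "b \<in> Basis" for b
    using that by (simp add: sum_nonneg_eq_0_iff)
  then have "frame_operator u = (\<lambda>x. c *\<^sub>R x)"
    by (intro linear_eq_stdbasis linear_frame_operator linear_scaleR) auto
  then show "tight_frame u"
    unfolding tight_frame_def frame_operator_def by metis
next
  assume "tight_frame u"
  then obtain c where c: "\<And>x. frame_operator u x = c *\<^sub>R x"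
    unfolding tight_frame_def frame_operator_def by metis
  have "c * real CARD('n) = real CARD('N)"
    using trace_frame_operator[OF assms] by (simp add: c mult.commute)
  then have "real CARD('N) / real CARD('n) = c"
    by (simp add: divide_eq_eq)
  with frame_potential_tight_defect[OF assms]
  have "frame_potential u - (real CARD('N))\<^sup>2 / real CARD('n) = 0"
    by (simp only: c) simp
  then show "frame_potential u = (real CARD('N))\<^sup>2 / real CARD('n)"
    by simp
qed

text \<open>Each row of the Gram matrix has diagonal entry 1, so the excess over
  \<open>CARD('N)\<close> is the sum of the squared off-diagonal entries.\<close>

lemma frame_potential_card_bound:
  fixes u :: "real ^ 'n ^ 'N"
  assumes "u \<in> unit_systems"
  shows "real CARD('N) \<le> frame_potential u"
    and "frame_potential u = real CARD('N) \<longleftrightarrow> orthonormal_system u"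
proof -
  have row: "(\<Sum>j\<in>UNIV. (u $ i \<bullet> u $ j)\<^sup>2) = 1 + (\<Sum>j\<in>-{i}. (u $ i \<bullet> u $ j)\<^sup>2)" for i
    by (subst sum.remove[of _ i]) (simp_all add: unit_systems_inner[OF assms] Compl_eq_Diff_UNIV)
  have eq: "frame_potential u = real CARD('N) + (\<Sum>i\<in>UNIV. \<Sum>j\<in>-{i}. (u $ i \<bullet> u $ j)\<^sup>2)"
    unfolding frame_potential_def row by (simp add: sum.distrib)
  show "real CARD('N) \<le> frame_potential u"
    unfolding eq by (simp add: sum_nonneg)
  have "frame_potential u = real CARD('N) \<longleftrightarrow> (\<forall>i. \<forall>j\<in>-{i}. u $ i \<bullet> u $ j = 0)"
    unfolding eq by (simp add: sum_nonneg_eq_0_iff sum_nonneg)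
  also have "\<dots> \<longleftrightarrow> orthonormal_system u"
    unfolding orthonormal_system_def
    by (metis Compl_iff singleton_iff unit_systems_inner[OF assms])
  finally show "frame_potential u = real CARD('N) \<longleftrightarrow> orthonormal_system u" .
qed

section \<open>Curves of unit systems and the expansion of the potential along them\<close>

lemma local_minimiser_along_curve:
  fixes v :: "real \<Rightarrow> 'a::topological_space"
  assumes "local_minimiser_on S f u" "\<And>t. v t \<in> S" "(v \<longlongrightarrow> u) F"
  shows "\<forall>\<^sub>F t in F. f u \<le> f (v t)"
proof -
  obtain T where T: "open T" "u \<in> T" "\<And>y. y \<in> S \<inter> T \<Longrightarrow> f u \<le> f y"
    using assms(1) unfolding local_minimiser_on_def openin_open by auto
  have "\<forall>\<^sub>F t in F. v t \<in> T"
    using assms(3) T(1,2) by (rule topological_tendstoD)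
  then show ?thesis
    by eventually_elim (use T(3) assms(2) in auto)
qed

text \<open>This is the radial projection of a straight line to the spheres whenever each
  \<open>d $ i\<close> is orthogonal to the unit vector \<open>u $ i\<close>: by Pythagoras the
  square root is then the norm of the shifted vector.\<close>

definition normalised_shift :: "real ^ 'n ^ 'N \<Rightarrow> real ^ 'n ^ 'N \<Rightarrow> real \<Rightarrow> real ^ 'n ^ 'N" where
  "normalised_shift u d t = (\<chi> i. (1 / sqrt (1 + t\<^sup>2 * (d $ i \<bullet> d $ i))) *\<^sub>R (u $ i + t *\<^sub>R d $ i))"

lemma one_plus_square_pos: "0 < 1 + t\<^sup>2 * (x \<bullet> x)" for t :: real
  by (smt (verit) inner_ge_zero mult_nonneg_nonneg zero_le_power2)

lemma normalised_shift_in_unit_systems: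
  assumes "u \<in> unit_systems" "\<And>i. u $ i \<bullet> d $ i = 0"
  shows "normalised_shift u d t \<in> unit_systems"
proof -
  have "normalised_shift u d t $ i \<bullet> normalised_shift u d t $ i = 1" for i
    using one_plus_square_pos[of t "d $ i"] assms(2)[of i] unit_systems_inner[OF assms(1), of i]
    by (simp add: normalised_shift_def inner_add_left inner_add_right inner_commute
        power2_eq_square field_simps flip: real_sqrt_mult)
  then show ?thesis by (simp add: unit_systems_def norm_eq_1)
qed

lemma tendsto_normalised_shift: "(normalised_shift u d \<longlongrightarrow> u) (at_right 0)"
proof (rule vec_tendstoI)
  fix i
  show "((\<lambda>t. normalised_shift u d t $ i) \<longlongrightarrow> u $ i) (at_right 0)"
    unfolding normalised_shift_def by (auto intro!: tendsto_eq_intros)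
qed

lemma frame_potential_normalised_shift:
  "frame_potential (normalised_shift u d t) = (\<Sum>i\<in>UNIV. \<Sum>j\<in>UNIV.
     (u $ i \<bullet> u $ j + t * (u $ i \<bullet> d $ j + d $ i \<bullet> u $ j) + t\<^sup>2 * (d $ i \<bullet> d $ j))\<^sup>2
       / ((1 + t\<^sup>2 * (d $ i \<bullet> d $ i)) * (1 + t\<^sup>2 * (d $ j \<bullet> d $ j))))"
proof -
  have sq: "(sqrt (1 + t\<^sup>2 * (d $ i \<bullet> d $ i)))\<^sup>2 = 1 + t\<^sup>2 * (d $ i \<bullet> d $ i)" for i
    using one_plus_square_pos[of t "d $ i"] by simp
  have "(normalised_shift u d t $ i \<bullet> normalised_shift u d t $ j)\<^sup>2 =
     (u $ i \<bullet> u $ j + t * (u $ i \<bullet> d $ j + d $ i \<bullet> u $ j) + t\<^sup>2 * (d $ i \<bullet> d $ j))\<^sup>2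
       / ((1 + t\<^sup>2 * (d $ i \<bullet> d $ i)) * (1 + t\<^sup>2 * (d $ j \<bullet> d $ j)))" for i j
    unfolding normalised_shift_def
    by (simp add: power_divide power_mult_distrib sq)
       (simp add: inner_add_left inner_add_right algebra_simps power2_eq_square)
  then show ?thesis
    unfolding frame_potential_def by simp
qed

text \<open>The quotient belongs to one summand of the potential along a shift. Over a common
  denominator the \<open>s\<^sup>2\<close> terms cancel and a factor \<open>t\<close> divides out,
  leaving a function continuous at 0.\<close>

lemma tendsto_first_order_quotient:
  fixes s r q a b :: real
  assumes "0 \<le> a" "0 \<le> b"
  shows "((\<lambda>t. ((s + t * r + t\<^sup>2 * q)\<^sup>2 / ((1 + t\<^sup>2 * a) * (1 + t\<^sup>2 * b)) - s\<^sup>2) / t)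
    \<longlongrightarrow> 2 * s * r) (at_right 0)"
proof (rule Lim_transform_eventually)
  let ?g = "\<lambda>t. (2 * s * r + t * (r\<^sup>2 + 2 * s * q - s\<^sup>2 * (a + b)) + t\<^sup>2 * (2 * r * q)
      + t ^ 3 * (q\<^sup>2 - s\<^sup>2 * a * b)) / ((1 + t\<^sup>2 * a) * (1 + t\<^sup>2 * b))"
  show "(?g \<longlongrightarrow> 2 * s * r) (at_right 0)"
    by (auto intro!: tendsto_eq_intros)
  show "\<forall>\<^sub>F t in at_right 0. ?g t
      = ((s + t * r + t\<^sup>2 * q)\<^sup>2 / ((1 + t\<^sup>2 * a) * (1 + t\<^sup>2 * b)) - s\<^sup>2) / t"
    using eventually_at_right_less[of 0]
  proof eventually_elim
    case (elim t)
    have "1 + t\<^sup>2 * a > 0" "1 + t\<^sup>2 * b > 0"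
      using assms by (smt (verit) mult_nonneg_nonneg zero_le_power2)+
    then have D: "(1 + t\<^sup>2 * a) * (1 + t\<^sup>2 * b) \<noteq> 0" by simp
    show ?case
      unfolding diff_divide_eq_iff[OF D]
      using D elim by (simp add: divide_simps) (simp add: algebra_simps power2_eq_square power3_eq_cube)
  qed
qed

text \<open>With \<open>s * r = 0\<close> the linear term of the numerator vanishes too, so even
  \<open>t\<^sup>2\<close> divides out.\<close>

lemma tendsto_second_order_quotient:
  fixes s r q a b :: real
  assumes "0 \<le> a" "0 \<le> b" "s * r = 0"
  shows "((\<lambda>t. ((s + t * r + t\<^sup>2 * q)\<^sup>2 / ((1 + t\<^sup>2 * a) * (1 + t\<^sup>2 * b)) - s\<^sup>2) / t\<^sup>2)
    \<longlongrightarrow> r\<^sup>2 + 2 * s * q - s\<^sup>2 * (a + b)) (at_right 0)"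
proof (rule Lim_transform_eventually)
  let ?g = "\<lambda>t. (r\<^sup>2 + 2 * s * q - s\<^sup>2 * (a + b) + t * (2 * r * q)
      + t\<^sup>2 * (q\<^sup>2 - s\<^sup>2 * a * b)) / ((1 + t\<^sup>2 * a) * (1 + t\<^sup>2 * b))"
  show "(?g \<longlongrightarrow> r\<^sup>2 + 2 * s * q - s\<^sup>2 * (a + b)) (at_right 0)"
    by (auto intro!: tendsto_eq_intros)
  show "\<forall>\<^sub>F t in at_right 0. ?g t
      = ((s + t * r + t\<^sup>2 * q)\<^sup>2 / ((1 + t\<^sup>2 * a) * (1 + t\<^sup>2 * b)) - s\<^sup>2) / t\<^sup>2"
    using eventually_at_right_less[of 0]
  proof eventually_elim
    case (elim t)
    have "1 + t\<^sup>2 * a > 0" "1 + t\<^sup>2 * b > 0"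
      using assms by (smt (verit) mult_nonneg_nonneg zero_le_power2)+
    then have D: "(1 + t\<^sup>2 * a) * (1 + t\<^sup>2 * b) \<noteq> 0" by simp
    have "s = 0 \<or> r = 0" using assms(3) by simp
    then show ?case
      unfolding diff_divide_eq_iff[OF D]
      using D elim by (elim disjE; simp add: divide_simps) (simp_all add: algebra_simps power2_eq_square)
  qed
qed

section \<open>First and second variation at a local minimiser\<close>

context
  fixes u :: "real ^ 'n ^ 'N"
  assumes local_min: "local_minimiser_on unit_systems frame_potential u"
begin

lemma in_unit_systems: "u \<in> unit_systems"
  using local_min unfolding local_minimiser_on_def by (auto dest: openin_imp_subset)

lemma shift_increases:
  assumes "\<And>i. u $ i \<bullet> d $ i = 0"
  shows "\<forall>\<^sub>F t in at_right 0. frame_potential u \<le> frame_potential (normalised_shift u d t)"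
  using local_min normalised_shift_in_unit_systems[OF in_unit_systems assms] tendsto_normalised_shift
  by (rule local_minimiser_along_curve)

text \<open>A one-sided limit gives only an inequality, which suffices because the direction
  \<open>d\<close> may be chosen with either sign.\<close>

lemma first_variation_nonneg:
  assumes "\<And>i. u $ i \<bullet> d $ i = 0"
  shows "0 \<le> (\<Sum>i\<in>UNIV. \<Sum>j\<in>UNIV. 2 * (u $ i \<bullet> u $ j) * (u $ i \<bullet> d $ j + d $ i \<bullet> u $ j))"
proof (rule tendsto_lowerbound)
  let ?Q = "\<lambda>t. (frame_potential (normalised_shift u d t) - frame_potential u) / t"
  show "(?Q \<longlongrightarrow> (\<Sum>i\<in>UNIV. \<Sum>j\<in>UNIV. 2 * (u $ i \<bullet> u $ j) * (u $ i \<bullet> d $ j + d $ i \<bullet> u $ j)))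
     (at_right 0)"
    unfolding frame_potential_normalised_shift
    unfolding frame_potential_def sum_subtractf[symmetric] sum_divide_distrib
    by (intro tendsto_sum tendsto_first_order_quotient) auto
  show "\<forall>\<^sub>F t in at_right 0. 0 \<le> ?Q t"
    using shift_increases[OF assms] eventually_at_right_less[of 0]
    by eventually_elim simp
qed simp

text \<open>The second assumption removes the linear term of every summand separately, so the limit
  can be taken summand by summand.\<close>

lemma second_variation_nonneg:
  assumes "\<And>i. u $ i \<bullet> d $ i = 0"
    and "\<And>i j. (u $ i \<bullet> u $ j) * (u $ i \<bullet> d $ j + d $ i \<bullet> u $ j) = 0"
  shows "0 \<le> (\<Sum>i\<in>UNIV. \<Sum>j\<in>UNIV. (u $ i \<bullet> d $ j + d $ i \<bullet> u $ j)\<^sup>2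
    + 2 * (u $ i \<bullet> u $ j) * (d $ i \<bullet> d $ j) - (u $ i \<bullet> u $ j)\<^sup>2 * (d $ i \<bullet> d $ i + d $ j \<bullet> d $ j))"
    (is "0 \<le> ?L")
proof (rule tendsto_lowerbound)
  let ?Q = "\<lambda>t. (frame_potential (normalised_shift u d t) - frame_potential u) / t\<^sup>2"
  show "(?Q \<longlongrightarrow> ?L) (at_right 0)"
    unfolding frame_potential_normalised_shift
    unfolding frame_potential_def sum_subtractf[symmetric] sum_divide_distrib
    by (intro tendsto_sum tendsto_second_order_quotient assms(2)) auto
  show "\<forall>\<^sub>F t in at_right 0. 0 \<le> ?Q t"
    using shift_increases[OF assms(1)] by eventually_elim simp
qed simp

section \<open>Spectrum of the frame operator at a local minimiser\<close>

lemma frame_operator_eigenvector: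
  "frame_operator u (u $ k) = (frame_operator u (u $ k) \<bullet> u $ k) *\<^sub>R u $ k"
proof -
  \<comment> \<open>\<open>w\<close> is the component of the image tangent to the sphere at
    \<open>u $ k\<close>. Moving only this vector, in direction \<open>- w\<close>, has first
    variation \<open>- 4 * (w \<bullet> w)\<close>, which forces \<open>w = 0\<close>.\<close>
  define w where "w = frame_operator u (u $ k) - (frame_operator u (u $ k) \<bullet> u $ k) *\<^sub>R u $ k"
  have w: "u $ k \<bullet> w = 0"
    by (simp add: w_def inner_diff_right unit_systems_inner[OF in_unit_systems] inner_commute)
  define d :: "real ^ 'n ^ 'N" where "d = (\<chi> i. if i = k then - w else 0)"
  have "0 \<le> (\<Sum>i\<in>UNIV. \<Sum>j\<in>UNIV. 2 * (u $ i \<bullet> u $ j) * (u $ i \<bullet> d $ j + d $ i \<bullet> u $ j))"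
    by (rule first_variation_nonneg) (simp add: d_def w)
  also have "\<dots> = (\<Sum>i\<in>UNIV. \<Sum>j\<in>UNIV. (if j = k then - 2 * (u $ i \<bullet> u $ k) * (w \<bullet> u $ i) else 0))
      + (\<Sum>i\<in>UNIV. \<Sum>j\<in>UNIV. (if i = k then - 2 * (u $ k \<bullet> u $ j) * (w \<bullet> u $ j) else 0))"
    unfolding sum.distrib[symmetric]
    by (intro sum.cong refl) (auto simp: d_def inner_commute algebra_simps)
  also have "(\<Sum>i\<in>UNIV. \<Sum>j\<in>UNIV. (if i = k then - 2 * (u $ k \<bullet> u $ j) * (w \<bullet> u $ j) else 0))
      = (\<Sum>j\<in>UNIV. \<Sum>i\<in>UNIV. (if i = k then - 2 * (u $ k \<bullet> u $ j) * (w \<bullet> u $ j) else 0))"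
    by (rule sum.swap)
  also have "(\<Sum>i\<in>UNIV. \<Sum>j\<in>UNIV. (if j = k then - 2 * (u $ i \<bullet> u $ k) * (w \<bullet> u $ i) else 0)) + \<dots>
      = - 4 * (frame_operator u (u $ k) \<bullet> w)"
    by (simp add: inner_frame_operator sum_distrib_left inner_commute[of "u $ k"] sum_negf mult.assoc)
  also have "frame_operator u (u $ k) \<bullet> w = w \<bullet> w"
    using w by (simp add: w_def inner_diff_left inner_diff_right inner_commute)
  finally have "w = 0"
    using inner_ge_zero[of w] by simp
  then show ?thesis by (simp add: w_def)
qed

text \<open>
  The coefficients \<open>c\<close> are those of the linear dependency that
  \<open>frame_operator u (u $ k) = l *\<^sub>R u $ k\<close> expresses; they vanish outside the \<open>l\<close>-eigenspace.
  Tilting each \<open>u $ i\<close> by \<open>t * c i\<close> towards a unit vector \<open>x\<close> orthogonal to that eigenspace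
  changes the potential only to second order, by a positive multiple of \<open>frame_operator u x \<bullet> x - l\<close>.
\<close>
lemma frame_operator_ge_orthogonal:
  assumes eig: "frame_operator u (u $ k) = l *\<^sub>R u $ k"
    and j: "j \<noteq> k" "u $ k \<bullet> u $ j \<noteq> 0"
    and x: "norm x = 1" "\<And>i. frame_operator u (u $ i) = l *\<^sub>R u $ i \<Longrightarrow> x \<bullet> u $ i = 0"
  shows "l \<le> frame_operator u x \<bullet> x"
proof -
  define c where "c i = u $ k \<bullet> u $ i - (if i = k then l else 0)" for i
  define I where "I = {i. frame_operator u (u $ i) = l *\<^sub>R u $ i}"
  \<comment> \<open>Every \<open>u $ j\<close> is an eigenvector, so indices outside
    \<open>I\<close> belong to other eigenvalues.\<close>
  have orth: "u $ i \<bullet> u $ j = 0" if "i \<in> I" "j \<notin> I" for i j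
    using that frame_operator_eigenvectors_orthogonal[of u "u $ i" l "u $ j"] frame_operator_eigenvector[of j]
    unfolding I_def by fastforce
  have k: "k \<in> I" using eig by (simp add: I_def)
  have c0: "c i = 0" if "i \<notin> I" for i
    using that orth[OF k that] k by (auto simp: c_def)
  have dep: "(\<Sum>i\<in>UNIV. c i *\<^sub>R u $ i) = 0"
  proof -
    have "(\<Sum>i\<in>UNIV. c i *\<^sub>R u $ i)
      = frame_operator u (u $ k) - (\<Sum>i\<in>UNIV. if i = k then l *\<^sub>R u $ i else 0)"
      unfolding frame_operator_def sum_subtractf[symmetric]
      by (rule sum.cong) (auto simp: c_def algebra_simps)
    then show ?thesis by (simp add: eig)
  qed
  have xI: "x \<bullet> u $ i = 0" if "i \<in> I" for i
    using that x(2) by (simp add: I_def)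
  have xx: "x \<bullet> x = 1" using x(1) by (simp add: norm_eq_1)
  define d :: "real ^ 'n ^ 'N" where "d = (\<chi> i. c i *\<^sub>R x)"
  have d: "u $ i \<bullet> d $ j = c j * (x \<bullet> u $ i)" "d $ i \<bullet> u $ j = c i * (x \<bullet> u $ j)"
      "d $ i \<bullet> d $ j = c i * c j" for i j
    by (simp_all add: d_def inner_commute xx)
  have cx: "c i * (x \<bullet> u $ i) = 0" for i
    using c0[of i] xI[of i] by auto
  have "0 \<le> (\<Sum>i\<in>UNIV. \<Sum>j\<in>UNIV. (u $ i \<bullet> d $ j + d $ i \<bullet> u $ j)\<^sup>2
    + 2 * (u $ i \<bullet> u $ j) * (d $ i \<bullet> d $ j) - (u $ i \<bullet> u $ j)\<^sup>2 * (d $ i \<bullet> d $ i + d $ j \<bullet> d $ j))"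
  proof (rule second_variation_nonneg)
    show "u $ i \<bullet> d $ i = 0" for i by (simp add: d cx)
    show "(u $ i \<bullet> u $ j) * (u $ i \<bullet> d $ j + d $ i \<bullet> u $ j) = 0" for i j
      unfolding d using c0[of i] c0[of j] xI[of i] xI[of j] orth[of i j] orth[of j i]
      by (cases "i \<in> I"; cases "j \<in> I") (simp_all add: inner_commute)
  qed
  also have "\<dots> = (\<Sum>i\<in>UNIV. \<Sum>j\<in>UNIV. (c j)\<^sup>2 * (x \<bullet> u $ i)\<^sup>2)
      + (\<Sum>i\<in>UNIV. \<Sum>j\<in>UNIV. (c i)\<^sup>2 * (x \<bullet> u $ j)\<^sup>2)
      + 2 * (\<Sum>i\<in>UNIV. \<Sum>j\<in>UNIV. (c i *\<^sub>R u $ i) \<bullet> (c j *\<^sub>R u $ j))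
      - (\<Sum>i\<in>UNIV. \<Sum>j\<in>UNIV. (c i)\<^sup>2 * (u $ i \<bullet> u $ j)\<^sup>2)
      - (\<Sum>i\<in>UNIV. \<Sum>j\<in>UNIV. (c j)\<^sup>2 * (u $ i \<bullet> u $ j)\<^sup>2)"
  proof -
    \<comment> \<open>The mixed product regroups into factors
      \<open>c i * (x \<bullet> u $ i)\<close>, which vanish: \<open>c\<close> is zero outside
      \<open>I\<close>, and \<open>x\<close> is orthogonal to the vectors indexed by
      \<open>I\<close>.\<close>
    have "(c j * (x \<bullet> u $ i) + c i * (x \<bullet> u $ j))\<^sup>2 = (c j)\<^sup>2 * (x \<bullet> u $ i)\<^sup>2 + (c i)\<^sup>2 * (x \<bullet> u $ j)\<^sup>2"
      for i j
    proof -
      have "(c j * (x \<bullet> u $ i)) * (c i * (x \<bullet> u $ j)) = (c i * (x \<bullet> u $ i)) * (c j * (x \<bullet> u $ j))"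
        by simp
      then have "(c j * (x \<bullet> u $ i)) * (c i * (x \<bullet> u $ j)) = 0"
        by (simp only: cx)
      then show ?thesis
        by (simp add: power2_sum power_mult_distrib mult.assoc)
    qed
    then show ?thesis
      unfolding d sum_distrib_left sum.distrib[symmetric] sum_subtractf[symmetric]
      by (intro sum.cong refl) (simp add: algebra_simps power2_eq_square)
  qed
  also have "(\<Sum>i\<in>UNIV. \<Sum>j\<in>UNIV. (c j)\<^sup>2 * (x \<bullet> u $ i)\<^sup>2)
      = (\<Sum>i\<in>UNIV. \<Sum>j\<in>UNIV. (c i)\<^sup>2 * (x \<bullet> u $ j)\<^sup>2)"
    by (rule sum.swap)
  also have "(\<Sum>i\<in>UNIV. \<Sum>j\<in>UNIV. (c j)\<^sup>2 * (u $ i \<bullet> u $ j)\<^sup>2)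
      = (\<Sum>i\<in>UNIV. \<Sum>j\<in>UNIV. (c i)\<^sup>2 * (u $ i \<bullet> u $ j)\<^sup>2)"
    by (subst sum.swap) (simp add: inner_commute)
  \<comment> \<open>This double sum is the squared norm of the linear dependency.\<close>
  also have "(\<Sum>i\<in>UNIV. \<Sum>j\<in>UNIV. (c i *\<^sub>R u $ i) \<bullet> (c j *\<^sub>R u $ j)) = 0"
    unfolding inner_sum_right[symmetric] dep by simp
  also have "(\<Sum>i\<in>UNIV. \<Sum>j\<in>UNIV. (c i)\<^sup>2 * (x \<bullet> u $ j)\<^sup>2)
      = (\<Sum>i\<in>UNIV. (c i)\<^sup>2) * (frame_operator u x \<bullet> x)"
    by (simp add: inner_frame_operator power2_eq_square sum_product)
  \<comment> \<open>Where \<open>c i\<close> is nonzero, \<open>i\<close> lies in \<open>I\<close>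
    and the row sum of squares is the eigenvalue \<open>l\<close>.\<close>
  also have "(\<Sum>i\<in>UNIV. \<Sum>j\<in>UNIV. (c i)\<^sup>2 * (u $ i \<bullet> u $ j)\<^sup>2) = (\<Sum>i\<in>UNIV. (c i)\<^sup>2) * l"
  proof -
    have "(c i)\<^sup>2 * (\<Sum>j\<in>UNIV. (u $ i \<bullet> u $ j)\<^sup>2) = (c i)\<^sup>2 * l" for i
    proof (cases "i \<in> I")
      case True
      then have "frame_operator u (u $ i) \<bullet> u $ i = l"
        by (simp add: I_def unit_systems_inner[OF in_unit_systems])
      then show ?thesis by (simp add: inner_frame_operator power2_eq_square)
    qed (simp add: c0)
    then show ?thesis
      by (simp only: sum_distrib_left[symmetric] sum_distrib_right)
  qed
  finally have "0 \<le> (\<Sum>i\<in>UNIV. (c i)\<^sup>2) * (frame_operator u x \<bullet> x - l)"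
    by (simp add: algebra_simps)
  \<comment> \<open>The vector at \<open>j\<close> is really tilted:
    \<open>c j = u $ k \<bullet> u $ j\<close> is nonzero.\<close>
  moreover have "0 < (\<Sum>i\<in>UNIV. (c i)\<^sup>2)"
    using j by (intro sum_pos2[of _ j]) (auto simp: c_def)
  ultimately show ?thesis
    by (simp add: zero_le_mult_iff)
qed

text \<open>On the \<open>l\<close>-eigenspace the quadratic form is exactly \<open>l\<close> times
  the squared norm; on its orthogonal complement \<open>frame_operator_ge_orthogonal\<close> applies
  after normalisation. Self-adjointness removes the cross terms.\<close>

lemma frame_operator_ge:
  assumes eig: "frame_operator u (u $ k) = l *\<^sub>R u $ k"
    and j: "j \<noteq> k" "u $ k \<bullet> u $ j \<noteq> 0"
  shows "l * (x \<bullet> x) \<le> frame_operator u x \<bullet> x"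
proof -
  interpret S: linear "frame_operator u" by (rule linear_frame_operator)
  define W where "W = {y. frame_operator u y = l *\<^sub>R y}"
  have sub: "subspace W"
    by (auto simp: W_def subspace_def S.zero S.add S.scale algebra_simps)
  then have "span W = W" by (simp add: span_eq_iff)
  with orthogonal_subspace_decomp_exists[of W x]
  obtain p q where p: "p \<in> W" and q: "\<And>w. w \<in> W \<Longrightarrow> orthogonal q w" and xpq: "x = p + q"
    by metis
  have Sp: "frame_operator u p = l *\<^sub>R p" using p by (simp add: W_def)
  have pq: "q \<bullet> p = 0" using q[OF p] by (simp add: orthogonal_def)
  have "l * (q \<bullet> q) \<le> frame_operator u q \<bullet> q"
  proof (cases "q = 0")
    case False
    define e where "e = (1 / norm q) *\<^sub>R q"
    have "l \<le> frame_operator u e \<bullet> e"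
    proof (rule frame_operator_ge_orthogonal[OF eig j])
      show "norm e = 1" using False by (simp add: e_def)
      show "e \<bullet> u $ i = 0" if "frame_operator u (u $ i) = l *\<^sub>R u $ i" for i
        using q[of "u $ i"] that by (simp add: e_def W_def orthogonal_def)
    qed
    also have "\<dots> = (frame_operator u q \<bullet> q) / (q \<bullet> q)"
      by (simp add: e_def S.scale dot_square_norm power2_eq_square)
    finally show ?thesis
      using False by (simp add: pos_le_divide_eq)
  qed (simp add: S.zero)
  moreover have "frame_operator u x \<bullet> x = l * (p \<bullet> p) + frame_operator u q \<bullet> q"
    using pq frame_operator_selfadjoint[of u q p]
    by (simp add: xpq S.add Sp inner_add_left inner_add_right inner_commute)
  moreover have "x \<bullet> x = p \<bullet> p + q \<bullet> q"
    using pq by (simp add: xpq inner_add_left inner_add_right inner_commute)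
  ultimately show ?thesis by (simp add: algebra_simps)
qed

lemma local_minimiser_tight_or_orthonormal: "tight_frame u \<or> orthonormal_system u"
proof (rule disjCI)
  assume "\<not> orthonormal_system u"
  then obtain i j where ij: "j \<noteq> i" "u $ i \<bullet> u $ j \<noteq> 0"
    using unit_systems_inner[OF in_unit_systems] unfolding orthonormal_system_def by metis
  define l where "l k = frame_operator u (u $ k) \<bullet> u $ k" for k
  have eig: "frame_operator u (u $ k) = l k *\<^sub>R u $ k" for k
    unfolding l_def by (rule frame_operator_eigenvector)
  \<comment> \<open>Thus \<open>l k\<close> exceeds 1 exactly when \<open>u $ k\<close> is not
    orthogonal to all the other vectors; \<open>coupled\<close> and \<open>coupled_index\<close> are
    the two directions.\<close>
  have l: "l k = 1 + (\<Sum>j\<in>-{k}. (u $ k \<bullet> u $ j)\<^sup>2)" for k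
    unfolding l_def inner_frame_operator power2_eq_square
    by (subst sum.remove[of _ k]) (simp_all add: unit_systems_inner[OF in_unit_systems] Compl_eq_Diff_UNIV)
  have coupled: "1 < l k" if "j \<noteq> k" "u $ k \<bullet> u $ j \<noteq> 0" for j k
    unfolding l using that by (simp add: sum_pos2[of _ j])
  have coupled_index: "\<exists>j. j \<noteq> k \<and> u $ k \<bullet> u $ j \<noteq> 0" if "1 < l k" for k
  proof (rule ccontr)
    assume "\<nexists>j. j \<noteq> k \<and> u $ k \<bullet> u $ j \<noteq> 0"
    then have "(\<Sum>j\<in>-{k}. (u $ k \<bullet> u $ j)\<^sup>2) = 0" by (intro sum.neutral) auto
    then show False using that l[of k] by simp
  qed
  have le: "l k \<le> l m" if "1 < l k" for k m
  proof -
    obtain j where "j \<noteq> k" "u $ k \<bullet> u $ j \<noteq> 0" using coupled_index[OF \<open>1 < l k\<close>] by blast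
    from frame_operator_ge[OF eig this, of "u $ m"] show ?thesis
      by (simp add: l_def[of m] unit_systems_inner[OF in_unit_systems])
  qed
  have li: "1 < l i" using coupled[OF ij] .
  \<comment> \<open>\<open>l i \<le> l m\<close> also gives \<open>1 < l m\<close>, so the
    comparison can be reversed.\<close>
  have "l m = l i" for m
    using le[OF li, of m] le[of m i] li by linarith
  then have eig_i: "frame_operator u (u $ m) = l i *\<^sub>R u $ m" for m
    using eig[of m] by metis
  have "frame_operator u x = l i *\<^sub>R x" for x
  proof -
    interpret S: linear "frame_operator u" by (rule linear_frame_operator)
    \<comment> \<open>The image of the operator lies in the span of the \<open>u $ k\<close>, where
      it acts as multiplication by \<open>l i\<close>. Hence \<open>y\<close> lies in the kernel,
      which the positive lower bound \<open>l i\<close> makes trivial.\<close>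
    define y where "y = frame_operator u x - l i *\<^sub>R x"
    have "frame_operator u (frame_operator u x) = (\<Sum>k\<in>UNIV. (x \<bullet> u $ k) *\<^sub>R frame_operator u (u $ k))"
      by (subst (2) frame_operator_def) (simp add: S.sum S.scale)
    also have "\<dots> = l i *\<^sub>R frame_operator u x"
      unfolding eig_i by (simp add: frame_operator_def[of u x] scaleR_sum_right mult.commute)
    finally have "frame_operator u y = 0"
      by (simp add: y_def S.diff S.scale)
    with frame_operator_ge[OF eig ij, of y] li have "y \<bullet> y \<le> 0"
      by (simp add: mult_le_0_iff)
    then have "y = 0" using inner_ge_zero[of y] by simp
    then show ?thesis by (simp add: y_def)
  qed
  then show "tight_frame u"
    unfolding tight_frame_def frame_operator_def by metis
qed

end

section \<open>Global minimisers\<close>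

lemma global_minimiser_imp_local:
  "global_minimiser_on S f x \<Longrightarrow> local_minimiser_on S f x"
  unfolding global_minimiser_on_def local_minimiser_on_def
  by (intro exI[of _ S]) auto

theorem theorem1:
  shows "(\<forall>u :: real ^ 'n ^ 'N.
            local_minimiser_on unit_systems frame_potential u \<longrightarrow>
            global_minimiser_on unit_systems frame_potential u) \<and>
         (\<forall>u :: real ^ 'n ^ 'N.
            global_minimiser_on unit_systems frame_potential u \<longrightarrow>
            (CARD('N) \<le> CARD('n) \<longrightarrow> orthonormal_system u) \<and>
            (CARD('n) \<le> CARD('N) \<longrightarrow> normalised_tight_frame u))"
proof (intro conjI allI impI)
  fix u :: "real ^ 'n ^ 'N"
  assume loc: "local_minimiser_on unit_systems frame_potential u"
  note u = in_unit_systems[OF loc]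
  \<comment> \<open>A tight or orthonormal system attains a lower bound valid for all unit
    systems.\<close>
  show "global_minimiser_on unit_systems frame_potential u"
    unfolding global_minimiser_on_def
    using local_minimiser_tight_or_orthonormal[OF loc] u
      frame_potential_card_bound(2)[OF u] frame_potential_eq_tight_iff[OF u]
      frame_potential_card_bound(1) frame_potential_ge_tight by metis
next
  fix u :: "real ^ 'n ^ 'N"
  assume "global_minimiser_on unit_systems frame_potential u"
  then have loc: "local_minimiser_on unit_systems frame_potential u"
    by (rule global_minimiser_imp_local)
  note u = in_unit_systems[OF loc]
  note ot = local_minimiser_tight_or_orthonormal[OF loc]
    frame_potential_card_bound[OF u] frame_potential_ge_tight[OF u] frame_potential_eq_tight_iff[OF u]
  {
    assume "CARD('N) \<le> CARD('n)"
    \<comment> \<open>A tight system now has potential at most \<open>CARD('N)\<close>, so it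
      attains the diagonal bound and is orthonormal.\<close>
    then have "(real CARD('N))\<^sup>2 / real CARD('n) \<le> real CARD('N)"
      by (simp add: power2_eq_square divide_le_eq mult_left_mono)
    then show "orthonormal_system u" using ot by linarith
  next
    assume "CARD('n) \<le> CARD('N)"
    \<comment> \<open>Now an orthonormal system has potential at most the trace bound, so it attains
      that bound and is tight.\<close>
    then have "real CARD('N) \<le> (real CARD('N))\<^sup>2 / real CARD('n)"
      by (simp add: power2_eq_square le_divide_eq mult_left_mono)
    then have "tight_frame u" using ot by linarith
    then show "normalised_tight_frame u"
      using u by (simp add: normalised_tight_frame_def unit_systems_def)
  }
qed

end
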